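(* Let $n\ge 1$, let $f:\{0,1\}^n\to\mathbb{R}$, and let $0<p<r<1$. Then $$ \Big(\frac{p}{r}\,\frac{1-r}{1-p}\Big)^n\,\mathrm{Var}_p(f)\;\le\;\mathrm{Var}_r\big(\mathbb{E}_{p/r}\big[f(\psi\cdot\xi)\,\big|\,\psi\big]\big). $$
   Context: For $q\in[0,1]$, $\mathbb{P}_q$ is the product measure on $\{0,1\}^n$ giving each coordinate the value $1$ with probability $q$ and $0$ with probability $1-q$; $\mathbb{E}_q$ and $\mathrm{Var}_q$ are expectation and variance with respect to $\mathbb{P}_q$. The configurations $\psi,\xi\in\{0,1\}^n$ are independent, with $\psi\sim\mathbb{P}_r$ and $\xi\sim\mathbb{P}_{p/r}$, and $\psi\cdot\xi$ is the coordinate-wise product. Thus $\mathbb{E}_{p/r}[f(\psi\cdot\xi)\,|\,\psi]$ is the function of $\psi$ obtained by averaging over $\xi\sim\mathbb{P}_{p/r}$ with $\psi$ fixed, and $\mathrm{Var}_r$ of it is taken over $\psi\sim\mathbb{P}_r$. *)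

theory Defs
  imports "HOL-Probability.Probability" "HOL-Probability.Product_PMF"
begin

text \<open>
  Points of the cube are functions on the naturals, with True for 1 and False for 0, that are
  False outside the index set \<open>{..<n}\<close>. The distribution below is supported on such functions, so
  the values of a function on the cube at any other argument never matter.
\<close>

definition cube_pmf :: "nat \<Rightarrow> real \<Rightarrow> (nat \<Rightarrow> bool) pmf" where
  "cube_pmf n q = Pi_pmf {..<n} False (\<lambda>_. bernoulli_pmf q)"

definition cube_mult :: "(nat \<Rightarrow> bool) \<Rightarrow> (nat \<Rightarrow> bool) \<Rightarrow> (nat \<Rightarrow> bool)" where
  "cube_mult \<psi> \<xi> = (\<lambda>i. \<psi> i \<and> \<xi> i)"

text \<open>
  For \<open>\<xi>\<close> distributed as \<open>cube_pmf n q\<close> and independent of \<open>\<psi>\<close>, this is the conditional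
  expectation of \<open>f (cube_mult \<psi> \<xi>)\<close> given \<open>\<psi>\<close>, as a function of the value of \<open>\<psi>\<close>.
\<close>

definition cond_exp_mult :: "nat \<Rightarrow> real \<Rightarrow> ((nat \<Rightarrow> bool) \<Rightarrow> real) \<Rightarrow> (nat \<Rightarrow> bool) \<Rightarrow> real" where
  "cond_exp_mult n q f \<psi> = measure_pmf.expectation (cube_pmf n q) (\<lambda>\<xi>. f (cube_mult \<psi> \<xi>))"

end

(*
  Averaging out the last coordinate splits the variance of f into the variance of the average g
  of the two halves f_1 and f_0 of f plus q (1 - q) times the second moment of the difference
  d = f_1 - f_0.  The operator f \<mapsto> E[f(\<psi> \<cdot> \<xi>) | \<psi>] maps the average at parameter p to
  the average at parameter r and scales the difference by p / r.  As it also preserves means, an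
  induction on n applies to both g and d, and each coordinate costs at most the factor
  (p / r) (1 - r) / (1 - p) = r (1 - r) (p / r)^2 / (p (1 - p)).
*)

theory Submission
  imports Defs
begin

lemma finite_set_cube_pmf: "finite (set_pmf (cube_pmf n q))"
  unfolding cube_pmf_def by (simp add: set_Pi_pmf finite_PiE_dflt)

text \<open>Finite support makes every real function integrable; as a simp rule this discharges the
  side conditions of linearity.\<close>

lemma integrable_cube_pmf [simp]:
  fixes f :: "(nat \<Rightarrow> bool) \<Rightarrow> real"
  shows "integrable (measure_pmf (cube_pmf n q)) f"
  by (rule integrable_measure_pmf_finite[OF finite_set_cube_pmf])

lemma expectation_cube_pmf_Suc:
  fixes f :: "(nat \<Rightarrow> bool) \<Rightarrow> real"
  assumes "0 \<le> q" "q \<le> 1"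
  shows "measure_pmf.expectation (cube_pmf (Suc n) q) f =
    q * measure_pmf.expectation (cube_pmf n q) (\<lambda>x. f (x(n := True))) +
    (1 - q) * measure_pmf.expectation (cube_pmf n q) (\<lambda>x. f (x(n := False)))"
proof -
  \<comment> \<open>Draw coordinate \<open>n\<close> first, then overwrite it in an independent
    point of the smaller cube.\<close>
  have "cube_pmf (Suc n) q =
      bernoulli_pmf q \<bind> (\<lambda>b. map_pmf (\<lambda>x. x(n := b)) (cube_pmf n q))"
    unfolding cube_pmf_def lessThan_Suc
    by (subst Pi_pmf_insert') (auto simp: map_pmf_def)
  moreover have "finite (set_pmf (map_pmf (\<lambda>x. x(n := b)) (cube_pmf n q)))" for b
    by (simp add: finite_set_cube_pmf)
  moreover have "set_pmf (bernoulli_pmf q) \<subseteq> {False, True}"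
    by auto
  ultimately show ?thesis
    using assms pmf_expectation_bind[of "{False, True}" "\<lambda>b. map_pmf (\<lambda>x. x(n := b)) (cube_pmf n q)"
        "bernoulli_pmf q" f]
    by simp
qed

lemma variance_cube_pmf:
  fixes f :: "(nat \<Rightarrow> bool) \<Rightarrow> real"
  shows "measure_pmf.variance (cube_pmf n q) f =
    measure_pmf.expectation (cube_pmf n q) (\<lambda>x. (f x)\<^sup>2) -
    (measure_pmf.expectation (cube_pmf n q) f)\<^sup>2"
  by (rule measure_pmf.variance_eq) auto

text \<open>Law of total variance over the last coordinate: a variable with values a and b of
  probabilities q and 1 - q has variance q (1 - q) (a - b)^2.\<close>

lemma variance_cube_pmf_Suc:
  fixes f :: "(nat \<Rightarrow> bool) \<Rightarrow> real"
  assumes "0 \<le> q" "q \<le> 1"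
  shows "measure_pmf.variance (cube_pmf (Suc n) q) f =
    measure_pmf.variance (cube_pmf n q)
      (\<lambda>x. q * f (x(n := True)) + (1 - q) * f (x(n := False))) +
    q * (1 - q) * measure_pmf.expectation (cube_pmf n q)
      (\<lambda>x. (f (x(n := True)) - f (x(n := False)))\<^sup>2)"
proof -
  let ?E = "measure_pmf.expectation (cube_pmf n q)"
  let ?g = "\<lambda>x. q * f (x(n := True)) + (1 - q) * f (x(n := False))"
  let ?d = "\<lambda>x. f (x(n := True)) - f (x(n := False))"
  have "measure_pmf.expectation (cube_pmf (Suc n) q) (\<lambda>x. (f x)\<^sup>2) =
      ?E (\<lambda>x. q * (f (x(n := True)))\<^sup>2 + (1 - q) * (f (x(n := False)))\<^sup>2)"
    using assms by (simp add: expectation_cube_pmf_Suc)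
  also have "\<dots> = ?E (\<lambda>x. (?g x)\<^sup>2 + q * (1 - q) * (?d x)\<^sup>2)"
    by (intro Bochner_Integration.integral_cong refl)
       (simp add: power2_eq_square algebra_simps)
  also have "\<dots> = ?E (\<lambda>x. (?g x)\<^sup>2) + q * (1 - q) * ?E (\<lambda>x. (?d x)\<^sup>2)"
    by simp
  finally show ?thesis
    unfolding variance_cube_pmf using assms by (simp add: expectation_cube_pmf_Suc)
qed

lemma cube_mult_upd:
  "cube_mult (\<psi>(n := b)) (\<xi>(n := c)) = (cube_mult \<psi> \<xi>)(n := b \<and> c)"
  by (auto simp: cube_mult_def)

lemma cond_exp_mult_lincomb:
  "cond_exp_mult n q (\<lambda>x. a * f x + b * g x) \<psi> =
    a * cond_exp_mult n q f \<psi> + b * cond_exp_mult n q g \<psi>"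
  by (simp add: cond_exp_mult_def)

lemma cond_exp_mult_Suc:
  assumes "0 \<le> q" "q \<le> 1"
  shows "cond_exp_mult (Suc n) q f (\<psi>(n := b)) =
    q * cond_exp_mult n q (\<lambda>x. f (x(n := b))) \<psi> +
    (1 - q) * cond_exp_mult n q (\<lambda>x. f (x(n := False))) \<psi>"
  using assms by (simp add: cond_exp_mult_def expectation_cube_pmf_Suc cube_mult_upd)

text \<open>For \<open>r\<close> in [0, 1], the coefficient \<open>r * q\<close> is the chance that
  the last coordinates of \<psi> and \<xi> are both 1.\<close>

lemma cond_exp_mult_Suc_average:
  assumes "0 \<le> q" "q \<le> 1"
  shows "r * cond_exp_mult (Suc n) q f (\<psi>(n := True)) +
      (1 - r) * cond_exp_mult (Suc n) q f (\<psi>(n := False)) =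
    cond_exp_mult n q (\<lambda>x. r * q * f (x(n := True)) + (1 - r * q) * f (x(n := False))) \<psi>"
  unfolding cond_exp_mult_Suc[OF assms] cond_exp_mult_lincomb by algebra

text \<open>The last coordinate of \<psi> affects the product only when that of \<xi> is 1, which
  has probability \<open>q\<close>; the other terms cancel.\<close>

lemma cond_exp_mult_Suc_diff:
  assumes "0 \<le> q" "q \<le> 1"
  shows "cond_exp_mult (Suc n) q f (\<psi>(n := True)) - cond_exp_mult (Suc n) q f (\<psi>(n := False)) =
    q * cond_exp_mult n q (\<lambda>x. f (x(n := True)) - f (x(n := False))) \<psi>"
proof -
  have "cond_exp_mult n q (\<lambda>x. f (x(n := True)) - f (x(n := False))) \<psi> =
      cond_exp_mult n q (\<lambda>x. f (x(n := True))) \<psi> -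
      cond_exp_mult n q (\<lambda>x. f (x(n := False))) \<psi>"
    by (simp add: cond_exp_mult_def)
  then show ?thesis
    unfolding cond_exp_mult_Suc[OF assms] by algebra
qed

text \<open>The product of independent points with parameters \<open>r\<close> and \<open>q\<close>
  has parameter \<open>r * q\<close>; the induction peels off one coordinate at a time.\<close>

lemma expectation_cond_exp_mult:
  assumes "0 \<le> r" "r \<le> 1" "0 \<le> q" "q \<le> 1"
  shows "measure_pmf.expectation (cube_pmf n r) (cond_exp_mult n q f) =
    measure_pmf.expectation (cube_pmf n (r * q)) f"
proof (induction n arbitrary: f)
  case 0
  show ?case
    by (simp add: cond_exp_mult_def cube_pmf_def cube_mult_def)
next
  case (Suc n)
  have rq: "0 \<le> r * q" "r * q \<le> 1"
    using assms by (auto intro: mult_le_one)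
  have "measure_pmf.expectation (cube_pmf (Suc n) r) (cond_exp_mult (Suc n) q f) =
      measure_pmf.expectation (cube_pmf n r)
        (\<lambda>\<psi>. r * cond_exp_mult (Suc n) q f (\<psi>(n := True)) +
              (1 - r) * cond_exp_mult (Suc n) q f (\<psi>(n := False)))"
    using assms(1,2) by (simp add: expectation_cube_pmf_Suc)
  also have "\<dots> = measure_pmf.expectation (cube_pmf n (r * q))
      (\<lambda>x. r * q * f (x(n := True)) + (1 - r * q) * f (x(n := False)))"
    unfolding cond_exp_mult_Suc_average[OF assms(3,4)] by (rule Suc.IH)
  also have "\<dots> = measure_pmf.expectation (cube_pmf (Suc n) (r * q)) f"
    using rq by (simp add: expectation_cube_pmf_Suc)
  finally show ?case .
qed

text \<open>The equation on \<open>c\<close> matches the coefficients of the squared difference on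
  the two sides: r (1 - r) for the outer variance, times q^2 from the scaling by \<open>q\<close>.
  Here \<open>r * q\<close> plays the role of p.\<close>

lemma variance_cond_exp_mult_ge:
  assumes r: "0 \<le> r" "r \<le> 1" and q: "0 \<le> q" "q \<le> 1"
    and c: "0 \<le> c" "c \<le> 1" "c * (r * q * (1 - r * q)) = r * (1 - r) * q\<^sup>2"
  shows "c ^ n * measure_pmf.variance (cube_pmf n (r * q)) f \<le>
    measure_pmf.variance (cube_pmf n r) (cond_exp_mult n q f)"
proof (induction n arbitrary: f)
  case 0
  \<comment> \<open>The cube of dimension 0 is a single point, so both variances vanish.\<close>
  show ?case
    by (simp add: variance_cube_pmf cube_pmf_def cond_exp_mult_def cube_mult_def)
next
  case (Suc n)
  let ?p = "r * q"
  let ?Ep = "measure_pmf.expectation (cube_pmf n ?p)"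
  let ?Er = "measure_pmf.expectation (cube_pmf n r)"
  let ?T = "cond_exp_mult n q"
  define g where "g = (\<lambda>x. ?p * f (x(n := True)) + (1 - ?p) * f (x(n := False)))"
  define d where "d = (\<lambda>x. f (x(n := True)) - f (x(n := False)))"
  have p: "0 \<le> ?p" "?p \<le> 1"
    using r q by (auto intro: mult_le_one)
  have cn: "0 \<le> c ^ n" "c ^ n \<le> 1"
    using c by (auto intro: power_le_one)
  \<comment> \<open>The induction hypothesis bounds only variances. A second moment also contains a
    squared mean, which \<open>?T\<close> preserves and which absorbs the factor
    \<open>c ^ n\<close> since that is at most 1.\<close>
  have "c ^ n * ?Ep (\<lambda>x. (d x)\<^sup>2) =
      c ^ n * measure_pmf.variance (cube_pmf n ?p) d + c ^ n * (?Ep d)\<^sup>2"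
    by (simp add: variance_cube_pmf algebra_simps)
  also have "\<dots> \<le> measure_pmf.variance (cube_pmf n r) (?T d) + 1 * (?Ep d)\<^sup>2"
    using cn by (intro add_mono Suc.IH mult_right_mono) auto
  also have "\<dots> = ?Er (\<lambda>x. (?T d x)\<^sup>2)"
    unfolding variance_cube_pmf using r q by (simp add: expectation_cond_exp_mult)
  finally have d: "c ^ n * ?Ep (\<lambda>x. (d x)\<^sup>2) \<le> ?Er (\<lambda>x. (?T d x)\<^sup>2)" .
  \<comment> \<open>The average part needs only \<open>c ^ n\<close>; the extra \<open>c\<close> is
    given away here, while the difference part uses it fully.\<close>
  have "c * (c ^ n * measure_pmf.variance (cube_pmf n ?p) g) \<le>
      1 * (c ^ n * measure_pmf.variance (cube_pmf n ?p) g)"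
    using c cn by (intro mult_right_mono mult_nonneg_nonneg measure_pmf.variance_positive)
  with Suc.IH[of g] have g: "c * (c ^ n * measure_pmf.variance (cube_pmf n ?p) g) \<le>
      measure_pmf.variance (cube_pmf n r) (?T g)"
    by linarith
  have "c ^ Suc n * measure_pmf.variance (cube_pmf (Suc n) ?p) f =
      c * (c ^ n * measure_pmf.variance (cube_pmf n ?p) g) +
      c * (?p * (1 - ?p)) * (c ^ n * ?Ep (\<lambda>x. (d x)\<^sup>2))"
    unfolding variance_cube_pmf_Suc[OF p] g_def d_def by (simp add: algebra_simps)
  also have "\<dots> \<le> measure_pmf.variance (cube_pmf n r) (?T g) +
      c * (?p * (1 - ?p)) * ?Er (\<lambda>x. (?T d x)\<^sup>2)"
    using c(1) r q p by (intro add_mono g mult_left_mono d mult_nonneg_nonneg) auto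
  \<comment> \<open>Rewriting with \<open>c(3)\<close> yields the coefficient r (1 - r) q^2, whose
    q^2 is the square of the scaling in the difference; the variance decomposition is then read
    backwards.\<close>
  also have "\<dots> = measure_pmf.variance (cube_pmf (Suc n) r) (cond_exp_mult (Suc n) q f)"
    unfolding variance_cube_pmf_Suc[OF r] cond_exp_mult_Suc_average[OF q]
      cond_exp_mult_Suc_diff[OF q] g_def[symmetric] d_def[symmetric] c(3)
    by (simp add: power_mult_distrib)
  finally show ?case .
qed

theorem mainTheorem2:
  fixes n :: nat and f :: "(nat \<Rightarrow> bool) \<Rightarrow> real" and p r :: real
  assumes "n \<ge> 1" and "0 < p" and "p < r" and "r < 1"
  shows "((p / r) * ((1 - r) / (1 - p))) ^ n * measure_pmf.variance (cube_pmf n p) f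
           \<le> measure_pmf.variance (cube_pmf n r) (cond_exp_mult n (p / r) f)"
proof -
  \<comment> \<open>Both factors are at most 1 because p < r < 1.\<close>
  have "p / r * ((1 - r) / (1 - p)) \<le> 1"
    using assms by (intro mult_le_one) auto
  \<comment> \<open>Both sides equal p^2 (1 - r) / r.\<close>
  moreover have "p / r * ((1 - r) / (1 - p)) * (p * (1 - p)) = r * (1 - r) * (p / r)\<^sup>2"
    using assms by (simp add: field_simps power2_eq_square)
  moreover have "r * (p / r) = p"
    using assms by simp
  ultimately show ?thesis
    using variance_cond_exp_mult_ge[of r "p / r" "p / r * ((1 - r) / (1 - p))" n f] assms
    by simp
qed

end
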